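(* For any games with activeness $G^g,H^h,J^j,K^k$, if $G^g=H^h$ and $J^j=K^k$, then $G^g+J^j=H^h+K^k$.
   Context: Let $\mathcal{B}=\{0,1\}$. Define $\mathbb{I}_0=\{\emptyset\}\times\mathcal{B}$ and $\mathbb{I}_n=2^{\mathbb{I}_{n-1}}\times\mathcal{B}$ for $n\ge1$; a game with activeness is an element of $\mathbb{I}=\bigcup_{n\ge0}\mathbb{I}_n$. A pair $(G,g)$ is written $G^g$; elements of $G$ are its options, $g=1$ meaning active. The outcome $o$ is defined recursively: $o(G^g)=\mathscr{N}$ if $g=1$ and some option has outcome $\mathscr{P}$, and $o(G^g)=\mathscr{P}$ otherwise. The sum is $G^g+H^h=(\{G'^{g'}+H^h:G'^{g'}\in G^g\}\cup\{G^g+H'^{h'}:H'^{h'}\in H^h\})^{\max\{g,h\}}$. $G^g=H^h$ means $o(G^g+X^x)=o(H^h+X^x)$ for all games $X^x$. *)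

theory Defs
  imports Main "HOL-Library.FSet"
begin

text \<open>
  A game is a set of games born earlier together with an activeness bit. Each level
  \<open>games_upto n\<close> is finite, so option sets are finite sets, and the datatype is the union
  of the levels (\<open>finite_games_upto\<close>, \<open>UN_games_upto\<close>). The bit \<open>1\<close> is \<open>True\<close>, and \<open>max\<close> is
  taken for \<open>False < True\<close>.
\<close>

datatype game = Game (options: "game fset") (active: bool)

fun games_upto :: "nat \<Rightarrow> game set" where
  "games_upto 0 = {Game {||} g |g. True}"
| "games_upto (Suc n) = {Game G g |G g. fset G \<subseteq> games_upto n}"

lemma games_upto_Suc: "games_upto n \<subseteq> games_upto (Suc n)"
  by (induction n) auto

lemma games_upto_mono: "m \<le> n \<Longrightarrow> games_upto m \<subseteq> games_upto n"
  using games_upto_Suc by (rule lift_Suc_mono_le)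

lemma finite_games_upto: "finite (games_upto n)"
proof (induction n)
  case 0
  show ?case by (simp add: full_SetCompr_eq)
next
  case (Suc n)
  have "games_upto (Suc n) \<subseteq> (\<lambda>(S, g). Game (Abs_fset S) g) ` (Pow (games_upto n) \<times> UNIV)"
  proof
    fix X assume "X \<in> games_upto (Suc n)"
    then obtain G g where "X = Game G g" "fset G \<subseteq> games_upto n" by auto
    then show "X \<in> (\<lambda>(S, g). Game (Abs_fset S) g) ` (Pow (games_upto n) \<times> UNIV)"
      by (intro image_eqI[where x = "(fset G, g)"]) (simp_all add: fset_inverse)
  qed
  then show ?case
    by (rule finite_subset) (intro finite_imageI finite_cartesian_product, simp_all add: Suc)
qed

lemma UN_games_upto: "(\<Union>n. games_upto n) = UNIV"
proof -
  have "\<exists>n. X \<in> games_upto n" for X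
  proof (induction X)
    case (Game G g)
    then obtain f where f: "\<And>X. X \<in> fset G \<Longrightarrow> X \<in> games_upto (f X)" by metis
    have "fset G \<subseteq> games_upto (\<Sum>X\<in>fset G. f X)"
    proof
      fix X assume X: "X \<in> fset G"
      then have "f X \<le> (\<Sum>X\<in>fset G. f X)" by (intro member_le_sum) auto
      with f[OF X] games_upto_mono show "X \<in> games_upto (\<Sum>X\<in>fset G. f X)" by blast
    qed
    then have "Game G g \<in> games_upto (Suc (\<Sum>X\<in>fset G. f X))" by simp
    then show ?case ..
  qed
  then show ?thesis by auto
qed

lemma size_option: "X |\<in>| G \<Longrightarrow> size X < size (Game G g)"
  by (induction G) (auto simp: size_fset_overloaded_simps)

datatype outcome = \<N> | \<P>

function outcome_of :: "game \<Rightarrow> outcome" where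
  "outcome_of (Game G g) = (if g \<and> (\<exists>X |\<in>| G. outcome_of X = \<P>) then \<N> else \<P>)"
  by pat_completeness auto
termination
  by (relation "measure size") (auto simp del: game.size intro: size_option)

instantiation game :: plus
begin

function plus_game :: "game \<Rightarrow> game \<Rightarrow> game" where
  "Game G g + Game H h =
     Game ((\<lambda>X. X + Game H h) |`| G |\<union>| (\<lambda>Y. Game G g + Y) |`| H) (max g h)"
  by pat_completeness auto
termination
  by (relation "measure (\<lambda>(X, Y). size X + size Y)") (auto simp del: game.size intro: size_option)

instance ..

end

definition game_eq :: "game \<Rightarrow> game \<Rightarrow> bool"  (infix "\<approx>" 50) where
  "G \<approx> H \<longleftrightarrow> (\<forall>X. outcome_of (G + X) = outcome_of (H + X))"

end

theory Submission imports Defs begin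

text \<open>Since \<open>\<approx>\<close> quantifies over all test games, a summand can be absorbed
  into the test. With associativity this lets \<open>\<approx>\<close> survive adding a game on the
  right, and with commutativity on the left. Replacing one summand at a time then gives the result
  by transitivity. Both laws are literal equalities of games, so they rewrite inside
  \<open>outcome_of\<close>.\<close>

lemma game_add_commute: "X + Y = Y + (X :: game)"
proof (induction X Y rule: plus_game.induct)
  case (1 G g H h)
  have "(\<lambda>X. X + Game H h) |`| G = (\<lambda>X. Game H h + X) |`| G"
    using 1(1) by (intro fset.map_cong0)
  moreover have "(\<lambda>Y. Game G g + Y) |`| H = (\<lambda>Y. Y + Game G g) |`| H"
    using 1(2) by (intro fset.map_cong0)
  ultimately show ?case by (simp add: max.commute funion_commute)
qed

lemma game_add_assoc: "(X + Y) + Z = X + (Y + (Z :: game))"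
\<comment> \<open>A move changes one of the three summands and shrinks it, so the total size
  drops.\<close>
proof (induction "size X + size Y + size Z" arbitrary: X Y Z rule: less_induct)
  case less
  obtain G g H h J j where XYZ: "X = Game G g" "Y = Game H h" "Z = Game J j"
    by (meson game.exhaust)
  have X: "(A + Y) + Z = A + (Y + Z)" if "A |\<in>| G" for A
    using size_option[OF that, of g] XYZ(1) by (intro less) simp
  have Y: "(X + B) + Z = X + (B + Z)" if "B |\<in>| H" for B
    using size_option[OF that, of h] XYZ(2) by (intro less) simp
  have Z: "(X + Y) + C = X + (Y + C)" if "C |\<in>| J" for C
    using size_option[OF that, of j] XYZ(3) by (intro less) simp
  have "(\<lambda>A. (A + Y) + Z) |`| G = (\<lambda>A. A + (Y + Z)) |`| G"
    using X by (intro fset.map_cong0)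
  moreover have "(\<lambda>B. (X + B) + Z) |`| H = (\<lambda>B. X + (B + Z)) |`| H"
    using Y by (intro fset.map_cong0)
  moreover have "(\<lambda>C. (X + Y) + C) |`| J = (\<lambda>C. X + (Y + C)) |`| J"
    using Z by (intro fset.map_cong0)
  \<comment> \<open>Either bracketing has three families of options, one for each summand moved in;
    they agree pairwise.\<close>
  ultimately show ?case
    unfolding XYZ by (simp add: fimage_funion fset.map_comp comp_def max.assoc funion_assoc)
qed

text \<open>Testing \<open>G + J\<close> against \<open>X\<close> is testing \<open>G\<close>
  against \<open>J + X\<close>.\<close>

lemma game_eq_add_right:
  assumes "G \<approx> H"
  shows "G + J \<approx> H + J"
  using assms by (simp add: game_eq_def game_add_assoc)

theorem theorem3p23:
  fixes G H J K :: game
  assumes "G \<approx> H" and "J \<approx> K"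
  shows "G + J \<approx> H + K"
proof -
  have "G + J \<approx> H + J" using assms(1) by (rule game_eq_add_right)
  moreover have "H + J \<approx> H + K"
    using game_eq_add_right[OF assms(2), of H] by (simp add: game_add_commute)
  ultimately show ?thesis by (simp add: game_eq_def)
qed

end
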